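(* Let $K$ be a field, let $R=K[x_1,\ldots,x_n]$ be a polynomial ring, and let $I$ be a normal square-free monomial ideal in $R$. Let $S=R[x_{n+1}]=K[x_1,\ldots,x_n,x_{n+1}]$. Then the ideal $L:=IS\cap (x_n,x_{n+1})$ of $S$ is normal.
   Context: For an ideal $I$ of a commutative ring $R$, an element $f\in R$ is integral over $I$ if there is an equation $f^k+c_1f^{k-1}+\cdots+c_{k-1}f+c_k=0$ with $c_i\in I^i$. The set $\overline{I}$ of elements integral over $I$ is the integral closure of $I$; $I$ is integrally closed if $I=\overline{I}$, and $I$ is normal if all powers $I^t$, $t\ge 1$, are integrally closed. A monomial ideal is square-free if it is generated by square-free monomials. *)

theory Defs
  imports "HOL-Algebra.Ideal_Product" "HOL-Library.Poly_Mapping"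
begin

section \<open>Integral closure of ideals\<close>

text \<open>\<open>ideal_power R I t\<close> is \<open>I\<^sup>t\<close>, computed in the monoid of ideals of \<open>R\<close>; in particular
  \<open>I\<^sup>0 = R\<close>.\<close>

definition ideal_power :: "('a, 'b) ring_scheme \<Rightarrow> 'a set \<Rightarrow> nat \<Rightarrow> 'a set" where
  "ideal_power R I t = I [^]\<^bsub>ideals_set R\<^esub> t"

text \<open>An equation of integral dependence has degree \<open>k \<ge> 1\<close>, and its leading coefficient is one.\<close>

definition integral_over :: "('a, 'b) ring_scheme \<Rightarrow> 'a set \<Rightarrow> 'a \<Rightarrow> bool" where
  "integral_over R I f \<longleftrightarrow>
     (\<exists>(k::nat) c. k \<ge> 1 \<and> (\<forall>i\<in>{1..k}. c i \<in> ideal_power R I i) \<and>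
        f [^]\<^bsub>R\<^esub> k \<oplus>\<^bsub>R\<^esub> (\<Oplus>\<^bsub>R\<^esub>i\<in>{1..k}. c i \<otimes>\<^bsub>R\<^esub> f [^]\<^bsub>R\<^esub> (k - i)) = \<zero>\<^bsub>R\<^esub>)"

definition integral_closure :: "('a, 'b) ring_scheme \<Rightarrow> 'a set \<Rightarrow> 'a set" where
  "integral_closure R I = {f \<in> carrier R. integral_over R I f}"

definition integrally_closed :: "('a, 'b) ring_scheme \<Rightarrow> 'a set \<Rightarrow> bool" where
  "integrally_closed R I \<longleftrightarrow> I = integral_closure R I"

definition normal_ideal :: "('a, 'b) ring_scheme \<Rightarrow> 'a set \<Rightarrow> bool" where
  "normal_ideal R I \<longleftrightarrow> ideal I R \<and> (\<forall>t\<ge>1. integrally_closed R (ideal_power R I t))"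


section \<open>Polynomial rings and square-free monomial ideals\<close>

text \<open>A polynomial maps exponent vectors \<open>m\<close> to coefficients, where \<open>m\<close> maps the index \<open>i\<close> of a
  variable to its exponent. The polynomials in \<open>x\<^sub>1, \<dots>, x\<^sub>n\<close> are those using only these variables,
  so that \<open>K[x\<^sub>1, \<dots>, x\<^sub>n]\<close> is literally a subset of \<open>K[x\<^sub>1, \<dots>, x\<^sub>n, x\<^sub>n\<^sub>+\<^sub>1]\<close>.\<close>

type_synonym 'k polynomial = "(nat \<Rightarrow>\<^sub>0 nat) \<Rightarrow>\<^sub>0 'k"

definition polynomial_ring :: "nat \<Rightarrow> ('k::comm_ring_1) polynomial ring" where
  "polynomial_ring n =
     \<lparr>carrier = {p. \<forall>m \<in> Poly_Mapping.keys p. Poly_Mapping.keys m \<subseteq> {1..n}},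
      mult = (*), one = 1, zero = 0, add = (+)\<rparr>"

definition monomial :: "(nat \<Rightarrow>\<^sub>0 nat) \<Rightarrow> ('k::comm_ring_1) polynomial" where
  "monomial m = Poly_Mapping.single m 1"

definition variable :: "nat \<Rightarrow> ('k::comm_ring_1) polynomial" where
  "variable i = monomial (Poly_Mapping.single i 1)"

definition squarefree_monomials :: "nat \<Rightarrow> ('k::comm_ring_1) polynomial set" where
  "squarefree_monomials n =
     {monomial m | m. Poly_Mapping.keys m \<subseteq> {1..n} \<and> (\<forall>i. Poly_Mapping.lookup m i \<le> 1)}"

definition squarefree_monomial_ideal :: "nat \<Rightarrow> ('k::comm_ring_1) polynomial set \<Rightarrow> bool" where
  "squarefree_monomial_ideal n I \<longleftrightarrow>
     (\<exists>A \<subseteq> squarefree_monomials n. I = Idl\<^bsub>polynomial_ring n\<^esub> A)"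

lemma polynomial_ring_cring: "cring (polynomial_ring n :: ('k::comm_ring_1) polynomial ring)"
proof -
  let ?C = "{p :: 'k polynomial. \<forall>m \<in> Poly_Mapping.keys p. Poly_Mapping.keys m \<subseteq> {1..n}}"
  have add: "p + q \<in> ?C" if "p \<in> ?C" "q \<in> ?C" for p q
    using that Poly_Mapping.keys_add[of p q] by blast
  have mult: "p * q \<in> ?C" if p: "p \<in> ?C" and q: "q \<in> ?C" for p q
  proof (intro CollectI ballI)
    fix m assume "m \<in> Poly_Mapping.keys (p * q)"
    then obtain a b where "m = a + b" "a \<in> Poly_Mapping.keys p" "b \<in> Poly_Mapping.keys q"
      using keys_mult[of p q] by blast
    then show "Poly_Mapping.keys m \<subseteq> {1..n}"
      using p q Poly_Mapping.keys_add[of a b] by blast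
  qed
  have one: "1 \<in> ?C" by simp
  have uminus: "- p \<in> ?C" if "p \<in> ?C" for p
    using that by simp
  let ?R = "polynomial_ring n :: 'k polynomial ring"
  have sel: "carrier ?R = ?C" "mult ?R = (*)" "one ?R = 1" "zero ?R = 0" "add ?R = (+)"
    by (simp_all add: polynomial_ring_def)
  have neg: "\<exists>y\<in>?C. y + x = 0" if "x \<in> ?C" for x
    using uminus[OF that] by (intro bexI[of _ "- x"]) simp_all
  have zero: "0 \<in> ?C" by simp
  show ?thesis
  proof (rule cringI)
    show "abelian_group ?R"
      by (rule abelian_groupI; unfold sel)
         (fact add | fact zero | fact neg | simp only: add.assoc | simp only: add.commute | simp)+
    show "comm_monoid ?R"
      by (rule comm_monoidI; unfold sel)
         (fact mult | fact one | simp only: mult.assoc | simp only: mult.commute | simp)+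
  qed (unfold sel, simp only: distrib_right)
qed

end

theory Submission
  imports Defs "HOL-Library.Set_Algebras"
begin

text \<open>For square-free \<open>I\<close> one has \<open>L\<^sup>t = I\<^sup>t S \<inter> (x\<^sub>n, x\<^sub>n\<^sub>+\<^sub>1)\<^sup>t\<close>, so a monomial lies in \<open>L\<^sup>t\<close> iff
  its part in \<open>x\<^sub>1, \<dots>, x\<^sub>n\<close> lies in \<open>I\<^sup>t\<close> and its degree in \<open>x\<^sub>n, x\<^sub>n\<^sub>+\<^sub>1\<close> is at least \<open>t\<close>.
  If \<open>f\<close> is integral over a monomial ideal \<open>M\<close>, then for some \<open>k\<close> all powers \<open>f\<^sup>j\<close> lie in \<open>M\<^sup>j\<^sup>-\<^sup>k\<close>;
  this property passes to every monomial of \<open>f\<close>. For \<open>M = L\<^sup>t\<close> the degree bound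
  follows by letting \<open>j\<close> grow, while for the part in \<open>x\<^sub>1, \<dots>, x\<^sub>n\<close> Dickson's lemma removes the error
  \<open>k\<close> and shows that this part is integral over \<open>I\<^sup>t\<close>, hence in \<open>I\<^sup>t\<close> by normality.\<close>

section \<open>Monomial ideals\<close>

definition exponents :: "nat \<Rightarrow> (nat \<Rightarrow>\<^sub>0 nat) set" where
  "exponents N = {m. Poly_Mapping.keys m \<subseteq> {1..N}}"

text \<open>Membership is read off the support: \<open>X + exponents N\<close> collects the
  exponents of monomials divisible by one from \<open>X\<close>. For \<open>X\<close> inside
  \<open>exponents N\<close> this is the ideal generated by those monomials, see
  \<open>genideal_eq_monomial_ideal\<close>.\<close>

definition monomial_ideal :: "nat \<Rightarrow> (nat \<Rightarrow>\<^sub>0 nat) set \<Rightarrow> ('k::comm_ring_1) polynomial set" where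
  "monomial_ideal N X = {f. Poly_Mapping.keys f \<subseteq> X + exponents N}"

text \<open>The exponents of \<open>t\<close>-fold products of generators, so that powers of
  monomial ideals become sumsets. The start \<open>{0}\<close> makes power zero the whole
  ring.\<close>

primrec nfold_sumset :: "'a::comm_monoid_add set \<Rightarrow> nat \<Rightarrow> 'a set" where
  "nfold_sumset X 0 = {0}"
| "nfold_sumset X (Suc t) = nfold_sumset X t + X"

lemma nfold_sumset_add: "nfold_sumset X (s + t) = nfold_sumset X s + nfold_sumset X t"
  by (induction t) (simp_all add: add.assoc)

lemma nfold_sumset_mult: "nfold_sumset X (s * t) = nfold_sumset (nfold_sumset X s) t"
  by (induction t) (simp_all add: nfold_sumset_add add.commute)

lemma zero_in_exponents [simp]: "0 \<in> exponents N"
  by (simp add: exponents_def)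

text \<open>Exponents are natural numbers, so nothing cancels in a sum and the supports simply
  unite.\<close>

lemma add_in_exponents_iff [simp]: "a + b \<in> exponents N \<longleftrightarrow> a \<in> exponents N \<and> b \<in> exponents N"
proof -
  have "Poly_Mapping.keys (a + b) = Poly_Mapping.keys a \<union> Poly_Mapping.keys b"
    by (auto simp: in_keys_iff lookup_add)
  then show ?thesis by (simp add: exponents_def)
qed

lemma exponents_plus_exponents: "exponents N + exponents N = exponents N"
  by (force simp: set_plus_def intro: exI[of _ 0])

lemma sumset_subset_exponents:
  "X \<subseteq> exponents N \<Longrightarrow> Y \<subseteq> exponents N \<Longrightarrow> X + Y \<subseteq> exponents N"
  by (auto simp: set_plus_def)

lemma nfold_sumset_subset_exponents: "X \<subseteq> exponents N \<Longrightarrow> nfold_sumset X t \<subseteq> exponents N"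
  by (induction t) (simp_all add: sumset_subset_exponents)

lemma upset_plus_upset:
  "(X + exponents N) + (Y + exponents N) = (X + Y) + exponents N"
proof -
  have "(X + exponents N) + (Y + exponents N) = (X + Y) + (exponents N + exponents N)"
    by (simp only: add.assoc add.left_commute)
  then show ?thesis by (simp only: exponents_plus_exponents)
qed

text \<open>The surplus \<open>t - s\<close> summands are themselves exponent vectors and are
  absorbed into the cofactor.\<close>

lemma upset_nfold_antimono:
  assumes "X \<subseteq> exponents N" "s \<le> t"
  shows "nfold_sumset X t + exponents N \<subseteq> nfold_sumset X s + exponents N"
proof -
  have "nfold_sumset X t + exponents N = nfold_sumset X s + (nfold_sumset X (t - s) + exponents N)"
    using assms(2) nfold_sumset_add[of X s "t - s"] by (simp add: add.assoc)
  also have "\<dots> \<subseteq> nfold_sumset X s + exponents N"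
    by (intro set_plus_mono2 order_refl sumset_subset_exponents nfold_sumset_subset_exponents assms)
  finally show ?thesis .
qed

section \<open>Arithmetic in the polynomial ring and the ideal property\<close>

lemma polynomial_ring_simps [simp]:
  "carrier (polynomial_ring N) = {p. Poly_Mapping.keys p \<subseteq> exponents N}"
  "mult (polynomial_ring N) = (*)" "one (polynomial_ring N) = 1"
  "zero (polynomial_ring N) = 0" "add (polynomial_ring N) = (+)"
  by (auto simp: polynomial_ring_def exponents_def)

lemma polynomial_ring_is_ring: "ring (polynomial_ring N :: ('k::comm_ring_1) polynomial ring)"
  using polynomial_ring_cring cring.axioms(1) by blast

lemma polynomial_ring_nat_pow [simp]:
  "f [^]\<^bsub>polynomial_ring N\<^esub> (k::nat) = (f::('k::comm_ring_1) polynomial) ^ k"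
  by (induction k) (simp_all add: nat_pow_def mult.commute)

lemma polynomial_ring_finsum:
  fixes g :: "'a \<Rightarrow> ('k::comm_ring_1) polynomial"
  assumes "finite A" "\<And>i. i \<in> A \<Longrightarrow> Poly_Mapping.keys (g i) \<subseteq> exponents N"
  shows "(\<Oplus>\<^bsub>polynomial_ring N\<^esub>i\<in>A. g i) = sum g A"
proof -
  interpret R: cring "polynomial_ring N :: 'k polynomial ring" by (rule polynomial_ring_cring)
  show ?thesis using assms
  proof (induction A)
    case (insert x A)
    then show ?case by (subst R.finsum_insert) auto
  qed simp
qed

lemma polynomial_ring_a_inv:
  fixes f :: "('k::comm_ring_1) polynomial"
  assumes "Poly_Mapping.keys f \<subseteq> exponents N"
  shows "a_inv (polynomial_ring N) f = - f"
proof -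
  interpret R: cring "polynomial_ring N :: 'k polynomial ring" by (rule polynomial_ring_cring)
  show ?thesis by (rule R.minus_equality) (use assms in auto)
qed

lemma keys_mult_subset: "Poly_Mapping.keys (f * g) \<subseteq> Poly_Mapping.keys f + Poly_Mapping.keys g"
  using keys_mult[of f g] unfolding set_plus_def by blast

lemma monomial_ideal_subset_carrier:
  "X \<subseteq> exponents N \<Longrightarrow> monomial_ideal N X \<subseteq> carrier (polynomial_ring N)"
  using sumset_subset_exponents[of X N "exponents N"] by (auto simp: monomial_ideal_def)

lemma monomial_ideal_mult:
  assumes "f \<in> monomial_ideal N X" "g \<in> monomial_ideal N Y"
  shows "f * g \<in> monomial_ideal N (X + Y)"
proof -
  have "Poly_Mapping.keys (f * g) \<subseteq> Poly_Mapping.keys f + Poly_Mapping.keys g"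
    by (rule keys_mult_subset)
  also have "\<dots> \<subseteq> (X + exponents N) + (Y + exponents N)"
    by (rule set_plus_mono2) (use assms in \<open>auto simp: monomial_ideal_def\<close>)
  finally show ?thesis by (simp add: monomial_ideal_def upset_plus_upset)
qed

lemma monomial_ideal_sum:
  assumes "\<And>i. i \<in> A \<Longrightarrow> f i \<in> monomial_ideal N X"
  shows "sum f A \<in> monomial_ideal N X"
  using Poly_Mapping.keys_sum[of f A] assms unfolding monomial_ideal_def by blast

lemma monomial_ideal_is_ideal:
  assumes "X \<subseteq> exponents N"
  shows "ideal (monomial_ideal N X) (polynomial_ring N :: ('k::comm_ring_1) polynomial ring)"
proof (rule idealI)
  let ?R = "polynomial_ring N :: 'k polynomial ring"
  note carr = monomial_ideal_subset_carrier[OF assms]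
  show "subgroup (monomial_ideal N X) (add_monoid ?R)"
  proof
    fix x :: "'k polynomial" assume x: "x \<in> monomial_ideal N X"
    have "inv\<^bsub>add_monoid ?R\<^esub> x = - x"
      using polynomial_ring_a_inv[of x N] carr x by (auto simp: a_inv_def)
    then show "inv\<^bsub>add_monoid ?R\<^esub> x \<in> monomial_ideal N X"
      using x by (simp add: monomial_ideal_def)
  next
    show "x \<otimes>\<^bsub>add_monoid ?R\<^esub> y \<in> monomial_ideal N X"
      if "x \<in> monomial_ideal N X" "y \<in> monomial_ideal N X" for x y :: "'k polynomial"
      using that Poly_Mapping.keys_add[of x y] by (auto simp: monomial_ideal_def)
  qed (use carr in \<open>simp_all add: monomial_ideal_def\<close>)
  have mult: "x * a \<in> monomial_ideal N X"
    if a: "a \<in> monomial_ideal N X" and x: "x \<in> carrier ?R" for a x :: "'k polynomial"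
    using monomial_ideal_mult[of x N "{0}" a X] a x by (simp add: monomial_ideal_def)
  then show "x \<otimes>\<^bsub>?R\<^esub> a \<in> monomial_ideal N X" "a \<otimes>\<^bsub>?R\<^esub> x \<in> monomial_ideal N X"
    if "a \<in> monomial_ideal N X" "x \<in> carrier ?R" for a x
    using that by (simp_all add: mult.commute)
qed (rule polynomial_ring_is_ring)

section \<open>Generation, products and powers of monomial ideals\<close>

lemma polynomial_eq_sum_terms:
  fixes f :: "'a \<Rightarrow>\<^sub>0 'b::comm_monoid_add"
  shows "f = (\<Sum>m\<in>Poly_Mapping.keys f. Poly_Mapping.single m (Poly_Mapping.lookup f m))"
  by (rule poly_mapping_eqI)
     (auto simp: lookup_sum lookup_single when_def in_keys_iff)

lemma polynomial_additive_closure: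
  fixes f :: "'a \<Rightarrow>\<^sub>0 'b::comm_monoid_add"
  assumes "0 \<in> H" "\<And>f g. f \<in> H \<Longrightarrow> g \<in> H \<Longrightarrow> f + g \<in> H"
    and "\<And>m. m \<in> Poly_Mapping.keys f
      \<Longrightarrow> Poly_Mapping.single m (Poly_Mapping.lookup f m) \<in> H"
  shows "f \<in> H"
proof -
  have "(\<Sum>m\<in>A. Poly_Mapping.single m (Poly_Mapping.lookup f m)) \<in> H"
    if "finite A" "A \<subseteq> Poly_Mapping.keys f" for A
    using that by (induction A) (auto intro: assms)
  from this[of "Poly_Mapping.keys f"] show ?thesis
    using polynomial_eq_sum_terms[of f] by simp
qed

text \<open>\<open>B\<close> may be anything between the monomials on \<open>X\<close> and the whole
  monomial ideal. This covers both generation by monomials and the extension of an ideal to a ring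
  with one more variable.\<close>

lemma genideal_eq_monomial_ideal:
  fixes B :: "('k::comm_ring_1) polynomial set"
  assumes X: "X \<subseteq> exponents N" and B: "B \<subseteq> monomial_ideal N X"
    and mon: "\<And>m. m \<in> X \<Longrightarrow> monomial m \<in> B"
  shows "Idl\<^bsub>polynomial_ring N\<^esub> B = monomial_ideal N X"
proof
  interpret R: cring "polynomial_ring N :: 'k polynomial ring" by (rule polynomial_ring_cring)
  show "Idl\<^bsub>polynomial_ring N\<^esub> B \<subseteq> monomial_ideal N X"
    by (intro R.genideal_minimal monomial_ideal_is_ideal X B)
  have carr: "B \<subseteq> carrier (polynomial_ring N)"
    using B monomial_ideal_subset_carrier[OF X] by blast
  interpret J: ideal "Idl\<^bsub>polynomial_ring N\<^esub> B" "polynomial_ring N :: 'k polynomial ring"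
    by (rule R.genideal_ideal[OF carr])
  show "monomial_ideal N X \<subseteq> Idl\<^bsub>polynomial_ring N\<^esub> B"
  proof
    fix f :: "'k polynomial" assume f: "f \<in> monomial_ideal N X"
    show "f \<in> Idl\<^bsub>polynomial_ring N\<^esub> B"
    proof (rule polynomial_additive_closure)
      fix m assume "m \<in> Poly_Mapping.keys f"
      with f obtain x r where m: "m = x + r" and x: "x \<in> X" and r: "r \<in> exponents N"
        by (auto simp: monomial_ideal_def set_plus_def)
      have "Poly_Mapping.single r (Poly_Mapping.lookup f m) * monomial x \<in> Idl\<^bsub>polynomial_ring N\<^esub> B"
        using J.I_l_closed[of "monomial x" "Poly_Mapping.single r (Poly_Mapping.lookup f m)"]
          R.genideal_self[OF carr] mon[OF x] r by auto
      then show "Poly_Mapping.single m (Poly_Mapping.lookup f m) \<in> Idl\<^bsub>polynomial_ring N\<^esub> B"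
        by (simp add: monomial_def mult_single m add.commute)
    qed (use J.zero_closed J.a_closed in auto)
  qed
qed

lemma ideal_prod_monomial_ideal:
  assumes X: "X \<subseteq> exponents N" and Y: "Y \<subseteq> exponents N"
  shows "ideal_prod (polynomial_ring N) (monomial_ideal N X) (monomial_ideal N Y)
    = (monomial_ideal N (X + Y) :: ('k::comm_ring_1) polynomial set)"
    (is "?P = _")
proof
  show "?P \<subseteq> monomial_ideal N (X + Y)"
  proof
    fix f :: "'k polynomial" assume "f \<in> ?P"
    then show "f \<in> monomial_ideal N (X + Y)"
    proof induction
      case (prod p q)
      then show ?case by (simp add: monomial_ideal_mult)
    next
      case (sum p q)
      then show ?case using Poly_Mapping.keys_add[of p q] by (auto simp: monomial_ideal_def)
    qed
  qed
  show "monomial_ideal N (X + Y) \<subseteq> ?P"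
  proof
    fix f :: "'k polynomial" assume f: "f \<in> monomial_ideal N (X + Y)"
    show "f \<in> ?P"
    proof (rule polynomial_additive_closure)
      show "0 \<in> ?P"
        using ideal_prod.prod[of 0 "monomial_ideal N X" 0 "monomial_ideal N Y"
            "polynomial_ring N :: 'k polynomial ring"]
        by (simp add: monomial_ideal_def)
      show "p + q \<in> ?P" if "p \<in> ?P" "q \<in> ?P" for p q
        using ideal_prod.sum[OF that] by simp
      fix m assume "m \<in> Poly_Mapping.keys f"
      with f obtain x y r where m: "m = x + y + r"
        and xyr: "x \<in> X" "y \<in> Y" "r \<in> exponents N"
        by (auto simp: monomial_ideal_def set_plus_def)
      have "monomial x \<in> (monomial_ideal N X :: 'k polynomial set)"
        using set_plus_intro[OF xyr(1) zero_in_exponents[of N]]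
        by (auto simp: monomial_ideal_def monomial_def)
      moreover have "Poly_Mapping.single (y + r) c \<in> monomial_ideal N Y" for c :: 'k
        using xyr by (auto simp: monomial_ideal_def)
      ultimately show "Poly_Mapping.single m (Poly_Mapping.lookup f m) \<in> ?P"
        using ideal_prod.prod[of "monomial x" "monomial_ideal N X"
            "Poly_Mapping.single (y + r) (Poly_Mapping.lookup f m)" "monomial_ideal N Y"
            "polynomial_ring N :: 'k polynomial ring"]
        by (simp add: monomial_def mult_single m add.assoc)
    qed
  qed
qed

lemma ideal_power_monomial_ideal:
  assumes "X \<subseteq> exponents N"
  shows "ideal_power (polynomial_ring N) (monomial_ideal N X) t
    = (monomial_ideal N (nfold_sumset X t) :: ('k::comm_ring_1) polynomial set)"
proof (induction t)
  case 0
  then show ?case by (simp add: ideal_power_def ideals_set_def monomial_ideal_def)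
next
  case (Suc t)
  then show ?case
    using ideal_prod_monomial_ideal[OF nfold_sumset_subset_exponents[OF assms] assms]
    by (simp add: ideal_power_def ideals_set_def nat_pow_def)
qed

section \<open>Integral dependence on a monomial ideal\<close>

text \<open>With \<open>k\<close> the degree of the equation, \<open>f ^ j\<close> for
  \<open>j > k\<close> is a combination of the \<open>f ^ (j - i)\<close> with coefficients in the
  \<open>i\<close>-th power of the ideal, so every descent by \<open>i\<close> is paid for by
  \<open>i\<close> factors from the ideal.\<close>

lemma integral_over_monomial_idealD:
  fixes f :: "('k::comm_ring_1) polynomial"
  assumes X: "X \<subseteq> exponents N" and f: "Poly_Mapping.keys f \<subseteq> exponents N"
    and int: "integral_over (polynomial_ring N) (monomial_ideal N X) f"
  obtains k where "\<And>j. f ^ j \<in> monomial_ideal N (nfold_sumset X (j - k))"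
proof -
  interpret R: cring "polynomial_ring N :: 'k polynomial ring" by (rule polynomial_ring_cring)
  have M: "ideal (monomial_ideal N (nfold_sumset X s)) (polynomial_ring N :: 'k polynomial ring)" for s
    by (intro monomial_ideal_is_ideal nfold_sumset_subset_exponents X)
  obtain k c where k: "k \<ge> 1"
    and c: "\<And>i. i \<in> {1..k} \<Longrightarrow> c i \<in> monomial_ideal N (nfold_sumset X i)"
    and eq: "f [^]\<^bsub>polynomial_ring N\<^esub> k \<oplus>\<^bsub>polynomial_ring N\<^esub>
      (\<Oplus>\<^bsub>polynomial_ring N\<^esub>i\<in>{1..k}. c i \<otimes>\<^bsub>polynomial_ring N\<^esub> f [^]\<^bsub>polynomial_ring N\<^esub> (k - i)) = 0"
    using int unfolding integral_over_def ideal_power_monomial_ideal[OF X] polynomial_ring_simps(4)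
    by blast
  have powc: "f ^ j \<in> carrier (polynomial_ring N)" for j
    using R.nat_pow_closed[of f j] f by simp
  have cc: "c i \<in> carrier (polynomial_ring N)" if "i \<in> {1..k}" for i
    using c[OF that] monomial_ideal_subset_carrier[OF nfold_sumset_subset_exponents[OF X]] by blast
  have "f ^ k + (\<Sum>i\<in>{1..k}. c i * f ^ (k - i)) = 0"
    using eq polynomial_ring_finsum[of "{1..k}" "\<lambda>i. c i * f ^ (k - i)" N]
      R.m_closed[OF cc powc] by simp
  then have fk: "f ^ k = - (\<Sum>i\<in>{1..k}. c i * f ^ (k - i))"
    by (simp add: eq_neg_iff_add_eq_0)
  have "f ^ j \<in> monomial_ideal N (nfold_sumset X (j - k))" for j
  proof (induction j rule: less_induct)
    case (less j)
    show ?case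
    proof (cases "j \<le> k")
      case True
      \<comment> \<open>Truncated subtraction gives \<open>j - k = 0\<close>, so the claim is mere
        membership in the ring.\<close>
      then show ?thesis using powc[of j] by (simp add: monomial_ideal_def)
    next
      case False
      have summand: "c i * f ^ (j - i) \<in> monomial_ideal N (nfold_sumset X (j - k))" if i: "i \<in> {1..k}" for i
      proof -
        have "f ^ (j - i) \<in> monomial_ideal N (nfold_sumset X (j - i - k))"
          using less.IH[of "j - i"] i False by auto
        from monomial_ideal_mult[OF c[OF i] this]
        have "c i * f ^ (j - i) \<in> monomial_ideal N (nfold_sumset X (i + (j - i - k)))"
          by (simp add: nfold_sumset_add del: diff_diff_left)
        \<comment> \<open>Truncation only helps: the inequality is strict when
          \<open>j - i < k\<close>.\<close>
        moreover have "j - k \<le> i + (j - i - k)" by linarith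
        ultimately show ?thesis
          using upset_nfold_antimono[OF X] unfolding monomial_ideal_def by blast
      qed
      have "f ^ j = f ^ k * f ^ (j - k)"
        using False by (simp flip: power_add)
      also have "\<dots> = - (\<Sum>i\<in>{1..k}. c i * (f ^ (k - i) * f ^ (j - k)))"
        by (simp add: fk sum_distrib_right mult.assoc)
      also have "\<dots> = - (\<Sum>i\<in>{1..k}. c i * f ^ (j - i))"
        using False by (intro arg_cong[of _ _ uminus] sum.cong) (simp_all flip: power_add)
      finally have fj: "f ^ j = - (\<Sum>i\<in>{1..k}. c i * f ^ (j - i))" .
      show ?thesis
        using monomial_ideal_sum[of "{1..k}", OF summand] unfolding fj by (simp add: monomial_ideal_def)
    qed
  qed
  then show ?thesis by (rule that)
qed

text \<open>A consequence of integrality over the ideal of \<open>X\<close> that is visibly stable under sums, unlike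
  integrality itself.\<close>

definition power_bounded ::
    "nat \<Rightarrow> (nat \<Rightarrow>\<^sub>0 nat) set \<Rightarrow> ('k::comm_ring_1) polynomial \<Rightarrow> bool" where
  "power_bounded N X f \<longleftrightarrow> (\<exists>k. \<forall>j. f ^ j \<in> monomial_ideal N (nfold_sumset X (j - k)))"

text \<open>In the binomial expansion the factors \<open>f ^ i\<close> and
  \<open>g ^ (j - i)\<close> fall short by at most \<open>k\<close> and \<open>l\<close>, so
  \<open>k + l\<close> bounds the shortfall of every term.\<close>

lemma power_bounded_add:
  assumes X: "X \<subseteq> exponents N" and "power_bounded N X f" "power_bounded N X g"
  shows "power_bounded N X (f + g)"
proof -
  obtain k l where f: "\<And>j. f ^ j \<in> monomial_ideal N (nfold_sumset X (j - k))"
    and g: "\<And>j. g ^ j \<in> monomial_ideal N (nfold_sumset X (j - l))"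
    using assms(2,3) unfolding power_bounded_def by blast
  have "(f + g) ^ j \<in> monomial_ideal N (nfold_sumset X (j - (k + l)))" for j
  proof -
    have "of_nat (j choose i) * f ^ i * g ^ (j - i) \<in> monomial_ideal N (nfold_sumset X (j - (k + l)))"
      if i: "i \<le> j" for i
    proof -
      have "of_nat (j choose i) \<in> (monomial_ideal N {0} :: 'a polynomial set)"
        by (simp add: monomial_ideal_def flip: single_of_nat)
      from monomial_ideal_mult[OF monomial_ideal_mult[OF this f] g]
      have "of_nat (j choose i) * f ^ i * g ^ (j - i)
          \<in> monomial_ideal N (nfold_sumset X ((i - k) + (j - i - l)))"
        by (simp add: nfold_sumset_add del: diff_diff_left)
      moreover have "j - (k + l) \<le> (i - k) + (j - i - l)" using i by linarith
      ultimately show ?thesis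
        using upset_nfold_antimono[OF X] unfolding monomial_ideal_def by blast
    qed
    then show ?thesis
      unfolding binomial_ring by (intro monomial_ideal_sum) auto
  qed
  then show ?thesis unfolding power_bounded_def by blast
qed

section \<open>Leading terms of products and powers\<close>

lemma lookup_mult_of_max:
  fixes p q :: "'a::{ordered_cancel_comm_monoid_add, linorder} \<Rightarrow>\<^sub>0 'b::ring"
  assumes p: "\<And>x. x \<in> Poly_Mapping.keys p \<Longrightarrow> x \<le> a" and q: "\<And>x. x \<in> Poly_Mapping.keys q \<Longrightarrow> x \<le> b"
  shows "Poly_Mapping.lookup (p * q) (a + b) = Poly_Mapping.lookup p a * Poly_Mapping.lookup q b"
proof -
  \<comment> \<open>What remains once the top terms are removed lives strictly below
    \<open>a\<close> and \<open>b\<close>. These are only upper bounds, so the top coefficients may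
    vanish.\<close>
  define p' q' where "p' = p - Poly_Mapping.single a (Poly_Mapping.lookup p a)"
    and "q' = q - Poly_Mapping.single b (Poly_Mapping.lookup q b)"
  have p': "x < a" if "x \<in> Poly_Mapping.keys p'" for x
    using that p[of x] by (auto simp: p'_def in_keys_iff lookup_minus lookup_single when_def split: if_splits)
  have q': "x < b" if "x \<in> Poly_Mapping.keys q'" for x
    using that q[of x] by (auto simp: q'_def in_keys_iff lookup_minus lookup_single when_def split: if_splits)
  \<comment> \<open>Of the three summands only the product of the top terms can reach
    \<open>a + b\<close>.\<close>
  have "p * q = Poly_Mapping.single (a + b) (Poly_Mapping.lookup p a * Poly_Mapping.lookup q b)
      + Poly_Mapping.single a (Poly_Mapping.lookup p a) * q' + p' * q"
    by (simp add: p'_def q'_def algebra_simps mult_single)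
  moreover have "a + b \<notin> Poly_Mapping.keys (Poly_Mapping.single a (Poly_Mapping.lookup p a) * q')"
    using keys_mult[of "Poly_Mapping.single a (Poly_Mapping.lookup p a)" q'] q'
    by (force split: if_splits)
  moreover have "a + b \<notin> Poly_Mapping.keys (p' * q)"
  proof
    assume "a + b \<in> Poly_Mapping.keys (p' * q)"
    then obtain x y where "a + b = x + y" "x \<in> Poly_Mapping.keys p'" "y \<in> Poly_Mapping.keys q"
      using keys_mult[of p' q] by blast
    then show False using add_less_le_mono[OF p' q, of x y] by simp
  qed
  ultimately show ?thesis by (simp add: lookup_add not_in_keys_iff_lookup_eq_zero)
qed

text \<open>The bound on the support is carried through the induction because
  \<open>lookup_mult_of_max\<close> needs it. Here \<open>of_nat j * m\<close> is a product in the
  convolution semiring on exponent vectors and equals the \<open>j\<close>-fold sum of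
  \<open>m\<close>.\<close>

lemma power_of_max:
  fixes f :: "('k::comm_ring_1) polynomial"
  assumes f: "\<And>x. x \<in> Poly_Mapping.keys f \<Longrightarrow> x \<le> m"
  shows "Poly_Mapping.lookup (f ^ j) (of_nat j * m) = Poly_Mapping.lookup f m ^ j
    \<and> (\<forall>x\<in>Poly_Mapping.keys (f ^ j). x \<le> of_nat j * m)"
proof (induction j)
  case (Suc j)
  have "Poly_Mapping.lookup (f * f ^ j) (m + of_nat j * m) = Poly_Mapping.lookup f m * Poly_Mapping.lookup f m ^ j"
    using lookup_mult_of_max[of f m "f ^ j" "of_nat j * m"] f Suc by simp
  moreover have "x \<le> m + of_nat j * m" if x: "x \<in> Poly_Mapping.keys (f * f ^ j)" for x
  proof -
    obtain y z where "x = y + z" "y \<in> Poly_Mapping.keys f" "z \<in> Poly_Mapping.keys (f ^ j)"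
      using x keys_mult[of f "f ^ j"] by blast
    then show ?thesis using f Suc by (auto intro: add_mono)
  qed
  ultimately show ?case by (simp add: distrib_right)
qed simp

lemma single_power:
  "(Poly_Mapping.single m c :: ('k::comm_ring_1) polynomial) ^ j = Poly_Mapping.single (of_nat j * m) (c ^ j)"
  by (induction j) (simp_all add: mult_single distrib_right)

text \<open>Only the leading monomial can be read off from the powers of \<open>f\<close>; the other ones are
  reached by subtracting the leading term.\<close>

lemma power_bounded_exponents:
  fixes f :: "('k::field) polynomial"
  assumes X: "X \<subseteq> exponents N" and "power_bounded N X f" "m \<in> Poly_Mapping.keys f"
  shows "\<exists>k. \<forall>j. of_nat j * m \<in> nfold_sumset X (j - k) + exponents N"
  using assms(2,3)
proof (induction "card (Poly_Mapping.keys f)" arbitrary: f rule: less_induct)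
  case less
  \<comment> \<open>The linear order on exponent vectors is compatible with addition, so the maximum
    behaves as a leading monomial.\<close>
  define a c where "a = Max (Poly_Mapping.keys f)" and "c = Poly_Mapping.lookup f a"
  have a: "a \<in> Poly_Mapping.keys f" and max: "\<And>x. x \<in> Poly_Mapping.keys f \<Longrightarrow> x \<le> a"
    unfolding a_def using less.prems(2) by (auto intro: Max_in)
  obtain k where k: "\<And>j. f ^ j \<in> monomial_ideal N (nfold_sumset X (j - k))"
    using less.prems(1) unfolding power_bounded_def by blast
  have ka: "of_nat j * a \<in> nfold_sumset X (j - k) + exponents N" for j
  proof -
    \<comment> \<open>The leading coefficient is a nonzero element of a field, so its powers do not
      vanish and the leading monomial of \<open>f ^ j\<close> survives.\<close>
    have "of_nat j * a \<in> Poly_Mapping.keys (f ^ j)"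
      using power_of_max[of f a j] max a by (simp add: in_keys_iff)
    then show ?thesis using k[of j] by (auto simp: monomial_ideal_def)
  qed
  show ?case
  proof (cases "m = a")
    case True
    then show ?thesis using ka by blast
  next
    case False
    define g where "g = f + Poly_Mapping.single a (- c)"
    have keys: "Poly_Mapping.keys g = Poly_Mapping.keys f - {a}"
      by (auto simp: g_def c_def in_keys_iff lookup_add lookup_single when_def split: if_splits)
    \<comment> \<open>\<open>ka\<close> is exactly what a single term needs. The sign sits in the
      coefficient, so that \<open>g\<close> is a sum and \<open>power_bounded_add\<close>
      applies.\<close>
    have "power_bounded N X (Poly_Mapping.single a (- c))"
      unfolding power_bounded_def
      by (intro exI[of _ k]) (use ka in \<open>auto simp: single_power monomial_ideal_def\<close>)
    then have "power_bounded N X g"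
      unfolding g_def using less.prems(1) power_bounded_add[OF X] by blast
    moreover have "card (Poly_Mapping.keys g) < card (Poly_Mapping.keys f)"
      unfolding keys using a by (intro psubset_card_mono) auto
    ultimately show ?thesis
      using less.hyps[of g] less.prems(2) False keys by blast
  qed
qed

section \<open>Removing a bounded error from multiples of an exponent\<close>

text \<open>Every tail of \<open>f\<close> attains its minimum; positions of such minima, chosen in
  increasing order, give the subsequence.\<close>

lemma nat_seq_mono_subseq:
  fixes f :: "nat \<Rightarrow> nat"
  obtains r :: "nat \<Rightarrow> nat" where "strict_mono r" "mono (\<lambda>i. f (r i))"
proof -
  have min: "\<exists>x\<ge>m. \<forall>j\<ge>x. f x \<le> f j" for m
    using ex_has_least_nat[of "\<lambda>x. m \<le> x" m f] order_trans by (metis order_refl)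
  obtain r where r: "\<And>i. \<forall>j\<ge>r i. f (r i) \<le> f j" "\<And>i. r i < r (Suc i)"
    using dependent_nat_choice[of "\<lambda>_ x. \<forall>j\<ge>x. f x \<le> f j" "\<lambda>_ x y. x < y"] min
    by (metis Suc_le_eq)
  have "strict_mono r" using r(2) by (simp add: strict_mono_Suc_iff)
  moreover from this have "mono (\<lambda>i. f (r i))"
    using r(1) by (simp add: mono_def strict_mono_less_eq)
  ultimately show ?thesis by (rule that)
qed

text \<open>Dickson's lemma for vectors indexed by \<open>A\<close>, refining one coordinate at a
  time: coordinates already treated stay monotone along a further subsequence.\<close>

lemma dickson_subseq:
  fixes f :: "nat \<Rightarrow> 'a \<Rightarrow> nat"
  assumes "finite A"
  shows "\<exists>r::nat \<Rightarrow> nat. strict_mono r \<and> (\<forall>x\<in>A. mono (\<lambda>i. f (r i) x))"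
  using assms
proof induction
  case empty
  show ?case by (intro exI[of _ "\<lambda>i. i"]) (simp add: strict_mono_def)
next
  case (insert x A)
  then obtain r :: "nat \<Rightarrow> nat" where r: "strict_mono r" "\<forall>y\<in>A. mono (\<lambda>i. f (r i) y)" by blast
  obtain q :: "nat \<Rightarrow> nat" where q: "strict_mono q" "mono (\<lambda>i. f (r (q i)) x)"
    by (rule nat_seq_mono_subseq[of "\<lambda>i. f (r i) x"])
  have "mono (\<lambda>i. f (r (q i)) y)" if "y \<in> A" for y
    using r(2) that q(1) by (auto simp: mono_def strict_mono_less_eq)
  then show ?case
    using r(1) q by (intro exI[of _ "\<lambda>i. r (q i)"]) (auto simp: strict_mono_def)
qed

text \<open>Multiplicities turn \<open>t\<close>-fold sums into vectors indexed by \<open>G\<close>,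
  to which Dickson's lemma applies; \<open>sum_in_nfold_sumset\<close> leads back.\<close>

lemma nfold_sumset_coefficients:
  fixes G :: "'a::comm_semiring_1 set"
  assumes "finite G" "s \<in> nfold_sumset G t"
  shows "\<exists>c. sum c G = t \<and> s = (\<Sum>g\<in>G. of_nat (c g) * g)"
  using assms(2)
proof (induction t arbitrary: s)
  case 0
  then show ?case by (intro exI[of _ "\<lambda>_. 0"]) simp
next
  case (Suc t)
  then obtain s' h where s: "s = s' + h" and h: "h \<in> G" and s': "s' \<in> nfold_sumset G t"
    by (auto elim: set_plus_elim)
  obtain c where c: "sum c G = t" "s' = (\<Sum>g\<in>G. of_nat (c g) * g)"
    using Suc.IH[OF s'] by blast
  define d where "d g = c g + (if g = h then 1 else 0)" for g
  have "sum d G = Suc t"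
    using c(1) h assms(1) by (simp add: d_def sum.distrib)
  moreover have "(\<Sum>g\<in>G. of_nat (d g) * g) = s' + (\<Sum>g\<in>G. if g = h then g else 0)"
    unfolding c(2) sum.distrib[symmetric] by (intro sum.cong) (auto simp: d_def algebra_simps)
  ultimately show ?case using s h assms(1) by (intro exI[of _ d]) simp
qed

lemma sum_in_nfold_sumset:
  fixes G :: "'a::comm_semiring_1 set"
  assumes "finite G"
  shows "(\<Sum>g\<in>G. of_nat (c g) * g) \<in> nfold_sumset G (sum c G)"
proof -
  have mult: "of_nat k * g \<in> nfold_sumset G k" if "g \<in> G" for k g
    using that by (induction k) (auto simp: distrib_right add.commute)
  have "(\<Sum>g\<in>F. of_nat (c g) * g) \<in> nfold_sumset G (sum c F)" if "finite F" "F \<subseteq> G" for F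
    using that by (induction F) (auto simp: nfold_sumset_add mult)
  then show ?thesis using assms by blast
qed

lemma lookup_of_nat_times:
  fixes m :: "nat \<Rightarrow>\<^sub>0 nat"
  shows "Poly_Mapping.lookup (of_nat j * m) i = j * Poly_Mapping.lookup m i"
  by (induction j) (simp_all add: distrib_right lookup_add)

text \<open>Write each multiple of \<open>u\<close> as a combination of \<open>G\<close> plus a remainder. By Dickson's lemma two of
  these representations are comparable in all coordinates, and their difference represents
  a multiple of \<open>u\<close> without the error \<open>k\<close>.\<close>

lemma multiple_in_upset:
  assumes G: "finite G" "G \<subseteq> exponents n"
    and u: "\<And>j. of_nat j * u \<in> nfold_sumset G (t * (j - k)) + exponents n"
  obtains d where "d \<ge> 1" "of_nat d * u \<in> nfold_sumset G (t * d) + exponents n"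
proof -
  \<comment> \<open>Taking the multiple \<open>k + s\<close> makes \<open>j - k\<close> equal to
    \<open>s\<close> without truncation.\<close>
  have "\<exists>c r. sum c G = t * s \<and> r \<in> exponents n
      \<and> of_nat (k + s) * u = (\<Sum>g\<in>G. of_nat (c g) * g) + r" for s
  proof -
    obtain v r where "of_nat (k + s) * u = v + r" "v \<in> nfold_sumset G (t * s)" "r \<in> exponents n"
      using u[of "k + s"] by (auto elim: set_plus_elim)
    moreover from this(2) obtain c where "sum c G = t * s" "v = (\<Sum>g\<in>G. of_nat (c g) * g)"
      using nfold_sumset_coefficients[OF G(1)] by blast
    ultimately show ?thesis by (intro exI[of _ c] exI[of _ r]) simp
  qed
  then have "\<forall>s. \<exists>q. sum (fst q) G = t * s \<and> snd q \<in> exponents n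
      \<and> of_nat (k + s) * u = (\<Sum>g\<in>G. of_nat (fst q g) * g) + snd q"
    by (simp only: split_paired_Ex fst_conv snd_conv) blast
  from choice[OF this] obtain q where q: "\<forall>s. sum (fst (q s)) G = t * s \<and> snd (q s) \<in> exponents n
      \<and> of_nat (k + s) * u = (\<Sum>g\<in>G. of_nat (fst (q s) g) * g) + snd (q s)"
    by blast
  define c r where "c s = fst (q s)" and "r s = snd (q s)" for s
  have c: "sum (c s) G = t * s" and r: "r s \<in> exponents n"
    and eq: "of_nat (k + s) * u = (\<Sum>g\<in>G. of_nat (c s g) * g) + r s" for s
    using q by (simp_all only: c_def r_def)
  \<comment> \<open>One vector per \<open>s\<close>, joining the multiplicities on \<open>G\<close>
    to the coordinates of the remainder.\<close>
  define F where "F s = case_sum (c s) (Poly_Mapping.lookup (r s))" for s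
  have "finite (Inl ` G \<union> Inr ` {1..n})" using G(1) by simp
  from dickson_subseq[OF this, of F] obtain \<phi> :: "nat \<Rightarrow> nat" where \<phi>: "strict_mono \<phi>"
    and mono: "\<And>x. x \<in> Inl ` G \<union> Inr ` {1..n} \<Longrightarrow> mono (\<lambda>i. F (\<phi> i) x)"
    by blast
  \<comment> \<open>Two comparable representations, the earlier to be subtracted from the later;
    strictness of \<phi> makes \<open>d\<close> positive.\<close>
  define s s' d where "s = \<phi> 0" and "s' = \<phi> 1" and "d = \<phi> 1 - \<phi> 0"
  have s': "s' = s + d" and d: "d \<ge> 1"
    using strict_monoD[OF \<phi>, of 0 1] by (auto simp: s_def s'_def d_def)
  have c_le: "c s g \<le> c s' g" if "g \<in> G" for g
    using monoD[OF mono, of "Inl g" 0 1] that by (simp add: F_def s_def s'_def)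
  have r_le: "Poly_Mapping.lookup (r s) i \<le> Poly_Mapping.lookup (r s') i" for i
  proof (cases "i \<in> {1..n}")
    case True
    then show ?thesis using monoD[OF mono, of "Inr i" 0 1] by (simp add: F_def s_def s'_def)
  next
    case False
    then have "Poly_Mapping.lookup (r s) i = 0"
      using r[of s] by (auto simp: exponents_def in_keys_iff)
    then show ?thesis by simp
  qed
  define c' where "c' g = c s' g - c s g" for g
  define r' where "r' = r s' - r s"
  have rr: "r s' = r s + r'"
    by (rule poly_mapping_eqI) (use r_le in \<open>simp add: r'_def lookup_add lookup_minus\<close>)
  have sum_c': "sum c' G = t * d"
    using c_le by (simp add: c'_def sum_subtractf_nat c s' algebra_simps)
  have c': "c s' g = c s g + c' g" if "g \<in> G" for g
    using c_le[OF that] by (simp add: c'_def)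
  \<comment> \<open>Both sides will contain \<open>of_nat (k + s) * u\<close>; cancelling it is
    where the error \<open>k\<close> disappears.\<close>
  have "of_nat (k + s) * u + of_nat d * u = of_nat (k + s') * u"
    by (simp add: s' algebra_simps)
  also have "\<dots> = (\<Sum>g\<in>G. of_nat (c s g) * g + of_nat (c' g) * g) + (r s + r')"
    unfolding eq rr by (intro arg_cong2[of _ _ _ _ "(+)"] sum.cong refl) (simp add: c' distrib_right)
  also have "\<dots> = ((\<Sum>g\<in>G. of_nat (c s g) * g) + r s) + ((\<Sum>g\<in>G. of_nat (c' g) * g) + r')"
    by (simp only: sum.distrib ac_simps)
  also have "\<dots> = of_nat (k + s) * u + ((\<Sum>g\<in>G. of_nat (c' g) * g) + r')"
    by (simp only: eq)
  finally have "of_nat (k + s) * u + of_nat d * u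
    = of_nat (k + s) * u + ((\<Sum>g\<in>G. of_nat (c' g) * g) + r')" .
  then have "of_nat d * u = (\<Sum>g\<in>G. of_nat (c' g) * g) + r'"
    by (simp only: add_left_cancel)
  moreover have "r' \<in> exponents n" using r[of s'] unfolding rr by simp
  ultimately show ?thesis
    using that[OF d] sum_in_nfold_sumset[OF G(1), of c'] sum_c' by auto
qed

text \<open>The monomial \<open>x^u\<close> is a root of \<open>T^d - x^(d u)\<close>. As
  \<open>x^(d u)\<close> lies in the \<open>d\<close>-th power of the ideal, this is an equation of
  integral dependence in which only the last coefficient is nonzero.\<close>

lemma exponent_in_integrally_closed:
  assumes X: "X \<subseteq> exponents N"
    and closed: "integrally_closed (polynomial_ring N) (monomial_ideal N X :: ('k::comm_ring_1) polynomial set)"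
    and d: "d \<ge> 1" "of_nat d * u \<in> nfold_sumset X d + exponents N" and u: "u \<in> exponents N"
  shows "u \<in> X + exponents N"
proof -
  let ?f = "monomial u :: 'k polynomial" and ?R = "polynomial_ring N :: 'k polynomial ring"
  interpret R: cring ?R by (rule polynomial_ring_cring)
  define c where "c i = (if i = d then - (?f ^ d) else 0)" for i
  have fc: "?f \<in> carrier ?R" using u by (simp add: monomial_def)
  have fd: "?f ^ d \<in> monomial_ideal N (nfold_sumset X d)"
    using d(2) by (simp add: monomial_def single_power monomial_ideal_def)
  have c: "c i \<in> monomial_ideal N (nfold_sumset X i)" for i
    using fd by (simp add: c_def monomial_ideal_def)
  have cf: "Poly_Mapping.keys (c i * ?f ^ (d - i)) \<subseteq> exponents N" for i
  proof -
    have "c i \<in> carrier ?R"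
      using c[of i] monomial_ideal_subset_carrier[OF nfold_sumset_subset_exponents[OF X]] by blast
    then have "c i \<otimes>\<^bsub>?R\<^esub> ?f [^]\<^bsub>?R\<^esub> (d - i) \<in> carrier ?R"
      by (intro R.m_closed R.nat_pow_closed fc)
    then show ?thesis by simp
  qed
  have "(\<Oplus>\<^bsub>?R\<^esub>i\<in>{1..d}. c i * ?f ^ (d - i)) = (\<Sum>i\<in>{1..d}. c i * ?f ^ (d - i))"
    by (rule polynomial_ring_finsum) (use cf in simp_all)
  also have "\<dots> = (\<Sum>i\<in>{1..d}. if i = d then - (?f ^ d) else 0)"
    by (intro sum.cong) (auto simp: c_def)
  also have "\<dots> = - (?f ^ d)" using d(1) by simp
  finally have "integral_over ?R (monomial_ideal N X) ?f"
    unfolding integral_over_def ideal_power_monomial_ideal[OF X]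
    by (intro exI[of _ d] exI[of _ c]) (use d(1) c in simp)
  then have "?f \<in> monomial_ideal N X"
    using closed fc unfolding integrally_closed_def integral_closure_def by blast
  then show ?thesis by (simp add: monomial_ideal_def monomial_def)
qed

section \<open>Degrees and splitting of exponent vectors\<close>

lemma lookup_le_of_nfold_sumset:
  assumes "\<forall>g\<in>G. Poly_Mapping.lookup g i \<le> (1::nat)" "s \<in> nfold_sumset G t"
  shows "Poly_Mapping.lookup s i \<le> t"
  using assms(2)
proof (induction t arbitrary: s)
  case (Suc t)
  then obtain a g where "s = a + g" "a \<in> nfold_sumset G t" "g \<in> G"
    by (auto elim: set_plus_elim)
  then show ?case using Suc.IH[of a] bspec[OF assms(1), of g] by (simp add: lookup_add)
qed simp

lemma lookup_eq_0_of_exponents: "r \<in> exponents n \<Longrightarrow> n < i \<Longrightarrow> Poly_Mapping.lookup r i = 0"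
  by (force simp: exponents_def in_keys_iff)

lemma exponents_mono: "n \<le> N \<Longrightarrow> exponents n \<subseteq> exponents N"
  by (force simp: exponents_def)

lemma exponents_plus_single:
  assumes "r \<in> exponents N" "Poly_Mapping.lookup r i > 0"
  shows "\<exists>r'\<in>exponents N. r = r' + Poly_Mapping.single i 1"
proof
  show eq: "r = (r - Poly_Mapping.single i 1) + Poly_Mapping.single i 1"
    by (rule poly_mapping_eqI)
       (use assms(2) in \<open>auto simp: lookup_add lookup_minus lookup_single when_def\<close>)
  show "r - Poly_Mapping.single i 1 \<in> exponents N"
    using assms(1) by (subst (asm) eq) simp
qed

lemma exponents_Suc_split:
  assumes "r \<in> exponents (n + 1)"
  obtains r' e where "r = r' + Poly_Mapping.single (n + 1) e" "r' \<in> exponents n"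
proof
  define e where "e = Poly_Mapping.lookup r (n + 1)"
  show "r = (r - Poly_Mapping.single (n + 1) e) + Poly_Mapping.single (n + 1) e"
    by (rule poly_mapping_eqI)
       (auto simp: e_def lookup_add lookup_minus lookup_single when_def)
  have "i \<in> {1..n}" if "i \<in> Poly_Mapping.keys (r - Poly_Mapping.single (n + 1) e)" for i
  proof -
    have "i \<noteq> n + 1" "i \<in> Poly_Mapping.keys r"
      using that by (auto simp: in_keys_iff e_def lookup_minus lookup_single when_def split: if_splits)
    then show ?thesis using assms by (force simp: exponents_def)
  qed
  then show "r - Poly_Mapping.single (n + 1) e \<in> exponents n"
    unfolding exponents_def by blast
qed

section \<open>Intersecting with two variables\<close>

text \<open>Exponents of generators of \<open>L\<close>: a square-free generator of \<open>I\<close>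
  containing \<open>x_n\<close> already lies in \<open>(x_n, x_(n+1))\<close>, any other one is
  multiplied by either variable.\<close>

definition edge_exponents :: "nat \<Rightarrow> (nat \<Rightarrow>\<^sub>0 nat) set \<Rightarrow> (nat \<Rightarrow>\<^sub>0 nat) set" where
  "edge_exponents n G = {g \<in> G. Poly_Mapping.lookup g n = 1} \<union>
    {g + Poly_Mapping.single i 1 | g i. g \<in> G \<and> Poly_Mapping.lookup g n = 0 \<and> i \<in> {n, n + 1}}"

lemma edge_exponents_subset:
  assumes "n \<ge> 1" "G \<subseteq> exponents n"
  shows "edge_exponents n G \<subseteq> exponents (n + 1)"
proof -
  have "Poly_Mapping.single i 1 \<in> exponents (n + 1)" if "i \<in> {n, n + 1}" for i
    using that assms(1) by (auto simp: exponents_def)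
  then show ?thesis
    using assms(2) exponents_mono[of n "n + 1"] by (auto simp: edge_exponents_def)
qed

text \<open>The degree in the two variables is exactly one: \<open>t\<close>-fold sums then reach
  degree \<open>t\<close>, and splitting off one such generator lowers the degree by no more than
  one.\<close>

lemma edge_exponent_degree:
  assumes "n \<ge> 1" "G \<subseteq> exponents n" "b \<in> edge_exponents n G"
  obtains g r where "b = g + r" "g \<in> G" "r \<in> exponents (n + 1)"
    "Poly_Mapping.lookup b n + Poly_Mapping.lookup b (n + 1) = 1"
proof -
  consider "b \<in> G" "Poly_Mapping.lookup b n = 1"
    | g i where "b = g + Poly_Mapping.single i 1" "g \<in> G" "Poly_Mapping.lookup g n = 0" "i \<in> {n, n + 1}"
    using assms(3) by (auto simp: edge_exponents_def)
  then show ?thesis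
  proof cases
    case 1
    then show ?thesis
      using that[of b 0] assms(2) lookup_eq_0_of_exponents[of b n "n + 1"] by auto
  next
    case 2
    have "Poly_Mapping.lookup g (n + 1) = 0"
      using 2(2) assms(2) lookup_eq_0_of_exponents[of g n "n + 1"] by auto
    moreover have "Poly_Mapping.single i 1 \<in> exponents (n + 1)"
      using 2(4) assms(1) by (auto simp: exponents_def)
    ultimately show ?thesis
      using that[OF 2(1,2)] 2 by (auto simp: lookup_add lookup_single when_def)
  qed
qed

text \<open>This is \<open>L\<^sup>t = I\<^sup>t S \<inter> (x\<^sub>n, x\<^sub>n\<^sub>+\<^sub>1)\<^sup>t\<close>. Square-freeness enters here: the \<open>t\<close> generators
  account for at most \<open>t\<close> factors \<open>x\<^sub>n\<close>, so an excess of \<open>x\<^sub>n\<close> or \<open>x\<^sub>n\<^sub>+\<^sub>1\<close> must come from the cofactor.\<close>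

lemma nfold_edge_exponents:
  assumes n: "n \<ge> 1" and G: "G \<subseteq> exponents n" and sqf: "\<forall>g\<in>G. Poly_Mapping.lookup g n \<le> 1"
  shows "nfold_sumset (edge_exponents n G) t + exponents (n + 1)
    = {a \<in> nfold_sumset G t + exponents (n + 1). t \<le> Poly_Mapping.lookup a n + Poly_Mapping.lookup a (n + 1)}"
proof (intro equalityI subsetI CollectI conjI)
  let ?w = "\<lambda>a. Poly_Mapping.lookup a n + Poly_Mapping.lookup a (n + 1)"
  have edge: "s \<in> nfold_sumset G t + exponents (n + 1) \<and> t \<le> ?w s"
    if "s \<in> nfold_sumset (edge_exponents n G) t" for s t
    using that
  proof (induction t arbitrary: s)
    case 0
    then show ?case by simp
  next
    case (Suc t)
    then obtain a b where s: "s = a + b" and a: "a \<in> nfold_sumset (edge_exponents n G) t"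
      and b: "b \<in> edge_exponents n G"
      by (auto elim: set_plus_elim)
    obtain g r where b': "b = g + r" "g \<in> G" "r \<in> exponents (n + 1)" and wb: "?w b = 1"
      using edge_exponent_degree[OF n G b] by metis
    obtain a' r' where a': "a = a' + r'" "a' \<in> nfold_sumset G t" "r' \<in> exponents (n + 1)"
      using Suc.IH[OF a] by (auto elim: set_plus_elim)
    have "s = (a' + g) + (r' + r)"
      by (simp add: s a' b' ac_simps)
    then have "s \<in> nfold_sumset G (Suc t) + exponents (n + 1)"
      using a' b' by (auto simp del: nfold_sumset.simps simp: nfold_sumset.simps(2))
    then show ?case using Suc.IH[OF a] wb by (simp add: s lookup_add)
  qed
  fix a assume "a \<in> nfold_sumset (edge_exponents n G) t + exponents (n + 1)"
  then obtain s r where a: "a = s + r" and s: "s \<in> nfold_sumset (edge_exponents n G) t"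
    and r: "r \<in> exponents (n + 1)"
    by (auto elim: set_plus_elim)
  obtain s' r' where s': "s = s' + r'" "s' \<in> nfold_sumset G t" "r' \<in> exponents (n + 1)"
    using edge[OF s] by (auto elim: set_plus_elim)
  have "a = s' + (r' + r)" by (simp add: a s' add.assoc)
  then show "a \<in> nfold_sumset G t + exponents (n + 1)" using s' r by auto
  show "t \<le> ?w a" using edge[OF s] by (simp add: a lookup_add)
next
  let ?w = "\<lambda>a. Poly_Mapping.lookup a n + Poly_Mapping.lookup a (n + 1)"
  let ?E = "edge_exponents n G"
  have main: "s + r \<in> nfold_sumset ?E t + exponents (n + 1)"
    if "s \<in> nfold_sumset G t" "r \<in> exponents (n + 1)" "t \<le> ?w (s + r)" for s r t
    using that
  proof (induction t arbitrary: s r)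
    case 0
    then show ?case by simp
  next
    case (Suc t)
    then obtain a g where s: "s = a + g" and a: "a \<in> nfold_sumset G t" and g: "g \<in> G"
      by (auto elim: set_plus_elim)
    \<comment> \<open>It suffices to split off one \<open>b\<close> from \<open>?E\<close>: the rest
      has degree at least \<open>t\<close>, so the induction hypothesis applies to it.\<close>
    have step: "s + r \<in> nfold_sumset ?E (Suc t) + exponents (n + 1)"
      if b: "b \<in> ?E" and r': "r' \<in> exponents (n + 1)" and sr: "s + r = (a + r') + b" for b r'
    proof -
      have "?w b = 1" using edge_exponent_degree[OF n G b] by metis
      then have "t \<le> ?w (a + r')"
        using Suc.prems(3) by (simp add: sr lookup_add)
      then obtain x y where "a + r' = x + y" "x \<in> nfold_sumset ?E t" "y \<in> exponents (n + 1)"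
        using Suc.IH[OF a r'] by (auto elim: set_plus_elim)
      then have "s + r = (x + b) + y" "x + b \<in> nfold_sumset ?E (Suc t)"
        using b sr by (auto simp: ac_simps)
      then show ?thesis using \<open>y \<in> _\<close> by auto
    qed
    show ?case
    proof (cases "Poly_Mapping.lookup g n = 1")
      case True
      then show ?thesis
        using step[of g r] g Suc.prems(2) by (simp add: edge_exponents_def s ac_simps)
    next
      case False
      then have gn: "Poly_Mapping.lookup g n = 0" using bspec[OF sqf g] by simp
      \<comment> \<open>In \<open>s = a + g\<close> only \<open>a\<close> can contain
        \<open>x_n\<close>, at most \<open>t\<close> times, and \<open>x_(n+1)\<close> is absent.
        Degree \<open>Suc t\<close> thus forces one of the two variables into \<open>r\<close>, from
        where it moves over to \<open>g\<close>.\<close>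
      have "Poly_Mapping.lookup a n \<le> t"
        using lookup_le_of_nfold_sumset[OF sqf a] .
      moreover have "Poly_Mapping.lookup s (n + 1) = 0"
        using lookup_eq_0_of_exponents subsetD[OF nfold_sumset_subset_exponents[OF G] Suc.prems(1)]
        by simp
      ultimately have "Poly_Mapping.lookup r n > 0 \<or> Poly_Mapping.lookup r (n + 1) > 0"
        using Suc.prems(3) gn unfolding s lookup_add by linarith
      then obtain i where i: "i \<in> {n, n + 1}" "Poly_Mapping.lookup r i > 0" by blast
      obtain r' where r': "r = r' + Poly_Mapping.single i 1" "r' \<in> exponents (n + 1)"
        using exponents_plus_single[OF Suc.prems(2) i(2)] by blast
      have "g + Poly_Mapping.single i 1 \<in> ?E"
        using g gn i(1) by (auto simp: edge_exponents_def)
      then show ?thesis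
        using step[of "g + Poly_Mapping.single i 1" r'] r' by (simp add: s ac_simps)
    qed
  qed
  fix a assume "a \<in> {a \<in> nfold_sumset G t + exponents (n + 1). t \<le> ?w a}"
  then show "a \<in> nfold_sumset ?E t + exponents (n + 1)"
    using main by (auto elim!: set_plus_elim)
qed

text \<open>Intersecting monomial ideals means intersecting their exponent sets, and
  \<open>nfold_edge_exponents\<close> for \<open>t = 1\<close> describes the result.\<close>

lemma monomial_ideal_edge_exponents:
  assumes n: "n \<ge> 1" and G: "G \<subseteq> exponents n" and sqf: "\<forall>g\<in>G. Poly_Mapping.lookup g n \<le> 1"
  shows "Idl\<^bsub>polynomial_ring (n + 1)\<^esub> (monomial_ideal n G)
      \<inter> Idl\<^bsub>polynomial_ring (n + 1)\<^esub> {variable n, variable (n + 1)}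
    = (monomial_ideal (n + 1) (edge_exponents n G) :: ('k::comm_ring_1) polynomial set)"
proof -
  let ?w = "\<lambda>a. Poly_Mapping.lookup a n + Poly_Mapping.lookup a (n + 1)"
  let ?P = "{Poly_Mapping.single n 1, Poly_Mapping.single (n + 1) 1} :: (nat \<Rightarrow>\<^sub>0 nat) set"
  have Gn: "G \<subseteq> exponents (n + 1)"
    using G exponents_mono[of n "n + 1"] by auto
  have P: "?P \<subseteq> exponents (n + 1)"
    using n by (auto simp: exponents_def)
  have mon: "monomial x \<in> (monomial_ideal N X :: 'k polynomial set)" if "x \<in> X" for x N X
    using set_plus_intro[OF that zero_in_exponents[of N]]
    by (auto simp: monomial_ideal_def monomial_def)
  have I: "Idl\<^bsub>polynomial_ring (n + 1)\<^esub> (monomial_ideal n G)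
      = (monomial_ideal (n + 1) G :: 'k polynomial set)"
  proof (rule genideal_eq_monomial_ideal[OF Gn])
    have "G + exponents n \<subseteq> G + exponents (n + 1)"
      by (intro set_plus_mono2 exponents_mono) auto
    then show "monomial_ideal n G \<subseteq> (monomial_ideal (n + 1) G :: 'k polynomial set)"
      by (auto simp: monomial_ideal_def)
  qed (rule mon)
  have V: "Idl\<^bsub>polynomial_ring (n + 1)\<^esub> {variable n, variable (n + 1)}
      = (monomial_ideal (n + 1) ?P :: 'k polynomial set)"
  proof (rule genideal_eq_monomial_ideal[OF P])
    show "{variable n, variable (n + 1)} \<subseteq> (monomial_ideal (n + 1) ?P :: 'k polynomial set)"
      unfolding variable_def using mon[of _ ?P] by blast
  qed (auto simp: variable_def)
  have w: "a \<in> ?P + exponents (n + 1) \<longleftrightarrow> 1 \<le> ?w a" if a: "a \<in> exponents (n + 1)" for a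
  proof
    assume "a \<in> ?P + exponents (n + 1)"
    then show "1 \<le> ?w a" by (auto elim!: set_plus_elim simp: lookup_add)
  next
    assume "1 \<le> ?w a"
    then have "\<exists>i\<in>{n, n + 1}. Poly_Mapping.lookup a i > 0" by auto
    then obtain i where i: "i \<in> {n, n + 1}" "Poly_Mapping.lookup a i > 0" by blast
    obtain r where r: "a = r + Poly_Mapping.single i 1" "r \<in> exponents (n + 1)"
      using exponents_plus_single[OF a i(2)] by blast
    have "Poly_Mapping.single i 1 \<in> ?P" using i(1) by auto
    from set_plus_intro[OF this r(2)] show "a \<in> ?P + exponents (n + 1)"
      by (simp only: r(1) add.commute)
  qed
  have "edge_exponents n G + exponents (n + 1) = {a \<in> G + exponents (n + 1). 1 \<le> ?w a}"
    using nfold_edge_exponents[OF n G sqf, of 1] by simp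
  also have "\<dots> = (G + exponents (n + 1)) \<inter> (?P + exponents (n + 1))"
    using w sumset_subset_exponents[OF Gn, of "exponents (n + 1)"] by blast
  finally show ?thesis unfolding I V by (auto simp: monomial_ideal_def)
qed

section \<open>Integral elements over powers of \<open>L\<close>\<close>

lemma integral_in_edge_power:
  fixes f :: "('k::field) polynomial"
  assumes n: "n \<ge> 1" and G: "finite G" "G \<subseteq> exponents n"
    and sqf: "\<forall>g\<in>G. Poly_Mapping.lookup g n \<le> 1"
    and closed: "integrally_closed (polynomial_ring n)
      (monomial_ideal n (nfold_sumset G t) :: 'k polynomial set)"
    and f: "Poly_Mapping.keys f \<subseteq> exponents (n + 1)"
    and int: "integral_over (polynomial_ring (n + 1))
      (monomial_ideal (n + 1) (nfold_sumset (edge_exponents n G) t)) f"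
  shows "f \<in> monomial_ideal (n + 1) (nfold_sumset (edge_exponents n G) t)"
  unfolding monomial_ideal_def
proof (intro CollectI subsetI)
  let ?w = "\<lambda>a. Poly_Mapping.lookup a n + Poly_Mapping.lookup a (n + 1)"
  let ?E = "edge_exponents n G"
  fix m assume m: "m \<in> Poly_Mapping.keys f"
  have X: "nfold_sumset ?E t \<subseteq> exponents (n + 1)"
    by (intro nfold_sumset_subset_exponents edge_exponents_subset n G)
  have "power_bounded (n + 1) (nfold_sumset ?E t) f"
    using integral_over_monomial_idealD[OF X f int] unfolding power_bounded_def by metis
  from power_bounded_exponents[OF X this m] obtain k
    where k: "\<And>j. of_nat j * m \<in> nfold_sumset ?E (t * (j - k)) + exponents (n + 1)"
    unfolding nfold_sumset_mult by blast
  have kG: "of_nat j * m \<in> nfold_sumset G (t * (j - k)) + exponents (n + 1)"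
    and kw: "t * (j - k) \<le> j * ?w m" for j
    using k[of j] unfolding nfold_edge_exponents[OF n G(2) sqf]
    by (simp_all add: lookup_of_nat_times distrib_left)
  have w: "t \<le> ?w m"
  proof (rule ccontr)
    assume "\<not> t \<le> ?w m"
    then obtain d where d: "t = Suc (?w m + d)" by (metis not_le less_imp_Suc_add)
    \<comment> \<open>One more than \<open>t * k\<close>: a degree deficit of at least one per
      factor accumulates to at least \<open>j\<close>, whereas \<open>kw\<close> allows at most
      \<open>t * k\<close>.\<close>
    define j where "j = Suc (t * k)"
    have "j * ?w m + j \<le> j * t" by (simp add: d)
    also have "j * t \<le> t * (j - k) + t * k"
      by (simp add: algebra_simps diff_mult_distrib2)
    also have "\<dots> \<le> j * ?w m + t * k" using kw[of j] by simp
    finally show False by (simp add: j_def)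
  qed
  obtain u e where mu: "m = u + Poly_Mapping.single (n + 1) e" and u: "u \<in> exponents n"
    using exponents_Suc_split[of m n] f m by blast
  \<comment> \<open>The generators in \<open>G\<close> do not involve \<open>x_(n+1)\<close>, so
    discarding that variable only replaces the remainder \<open>r\<close> by
    \<open>r'\<close>.\<close>
  have "of_nat j * u \<in> nfold_sumset G (t * (j - k)) + exponents n" for j
  proof -
    obtain s r where sr: "of_nat j * m = s + r" and s: "s \<in> nfold_sumset G (t * (j - k))"
      and r: "r \<in> exponents (n + 1)"
      using kG[of j] by (auto elim: set_plus_elim)
    obtain r' e' where r': "r = r' + Poly_Mapping.single (n + 1) e'" "r' \<in> exponents n"
      using exponents_Suc_split[OF r] by blast
    have sn: "s \<in> exponents n" using s nfold_sumset_subset_exponents[OF G(2)] by blast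
    have "of_nat j * u = s + r'"
    proof (rule poly_mapping_eqI)
      fix i
      have "Poly_Mapping.lookup (of_nat j * m) i = Poly_Mapping.lookup (s + r) i"
        by (simp only: sr)
      then show "Poly_Mapping.lookup (of_nat j * u) i = Poly_Mapping.lookup (s + r') i"
        using lookup_eq_0_of_exponents[OF u, of i] lookup_eq_0_of_exponents[OF sn, of i]
          lookup_eq_0_of_exponents[OF r'(2), of i]
        by (cases "i = n + 1")
           (simp_all add: lookup_of_nat_times lookup_add mu r'(1) lookup_single when_def)
    qed
    then show ?thesis using s r'(2) by auto
  qed
  from multiple_in_upset[OF G this] obtain d
    where d: "d \<ge> 1" "of_nat d * u \<in> nfold_sumset G (t * d) + exponents n" by blast
  \<comment> \<open>By \<open>nfold_sumset_mult\<close> the multiple \<open>of_nat d * u\<close>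
    belongs to the \<open>d\<close>-th power of the ideal of \<open>nfold_sumset G t\<close>;
    closedness of that ideal removes \<open>d\<close>.\<close>
  have "u \<in> nfold_sumset G t + exponents n"
    using exponent_in_integrally_closed[OF nfold_sumset_subset_exponents[OF G(2)] closed d(1) _ u]
      d(2) by (simp add: nfold_sumset_mult)
  then obtain s r where sr: "u = s + r" "s \<in> nfold_sumset G t" "r \<in> exponents n"
    by (auto elim: set_plus_elim)
  \<comment> \<open>The power of \<open>x_(n+1)\<close> split off from \<open>m\<close> returns as
    part of the cofactor.\<close>
  have single: "Poly_Mapping.single (n + 1) e \<in> exponents (n + 1)"
    by (simp add: exponents_def)
  have "r + Poly_Mapping.single (n + 1) e \<in> exponents (n + 1)"
    using sr(3) exponents_mono[of n "n + 1"] single by auto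
  from set_plus_intro[OF sr(2) this] have "m \<in> nfold_sumset G t + exponents (n + 1)"
    by (simp only: mu sr(1) add.assoc)
  then show "m \<in> nfold_sumset ?E t + exponents (n + 1)"
    unfolding nfold_edge_exponents[OF n G(2) sqf] using w by simp
qed

section \<open>Square-free generators and normality of \<open>L\<close>\<close>

lemma integral_over_self:
  fixes f :: "('k::comm_ring_1) polynomial"
  assumes "X \<subseteq> exponents N" "f \<in> monomial_ideal N X"
  shows "integral_over (polynomial_ring N) (monomial_ideal N X) f"
proof -
  have f: "Poly_Mapping.keys f \<subseteq> exponents N"
    using subsetD[OF monomial_ideal_subset_carrier[OF assms(1)] assms(2)] by simp
  \<comment> \<open>The equation has degree one, with \<open>c 1 = - f\<close>.\<close>
  have "- f \<in> monomial_ideal N X" using assms(2) by (simp add: monomial_ideal_def)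
  moreover have "(\<Oplus>\<^bsub>polynomial_ring N\<^esub>i\<in>{1..1}. (- f) * f ^ (1 - i)) = - f"
    using polynomial_ring_finsum[of "{1..1::nat}" "\<lambda>i. (- f) * f ^ (1 - i)" N] f by simp
  ultimately show ?thesis
    unfolding integral_over_def ideal_power_monomial_ideal[OF assms(1)]
    by (intro exI[of _ 1] exI[of _ "\<lambda>_. - f"]) simp
qed

text \<open>A square-free exponent vector is determined by its support, a subset of
  \<open>{1..n}\<close>.\<close>

lemma finite_squarefree_exponents:
  "finite {m \<in> exponents n. \<forall>i. Poly_Mapping.lookup m i \<le> 1}" (is "finite ?A")
proof (rule finite_imageD)
  show "finite (Poly_Mapping.keys ` ?A)"
    by (rule finite_subset[of _ "Pow {1..n}"]) (auto simp: exponents_def)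
  show "inj_on Poly_Mapping.keys ?A"
  proof (rule inj_onI, rule poly_mapping_eqI)
    fix a b i assume "a \<in> ?A" "b \<in> ?A" and keys: "Poly_Mapping.keys a = Poly_Mapping.keys b"
    then have "Poly_Mapping.lookup a i \<le> 1" "Poly_Mapping.lookup b i \<le> 1" by auto
    moreover have "Poly_Mapping.lookup a i = 0 \<longleftrightarrow> Poly_Mapping.lookup b i = 0"
      using keys by (metis in_keys_iff)
    ultimately show "Poly_Mapping.lookup a i = Poly_Mapping.lookup b i" by linarith
  qed
qed

text \<open>Finiteness of \<open>G\<close>, which \<open>multiple_in_upset\<close> requires, holds
  because \<open>n\<close> variables have only finitely many square-free monomials.\<close>

lemma squarefree_monomial_idealE:
  fixes I :: "('k::comm_ring_1) polynomial set"
  assumes "squarefree_monomial_ideal n I"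
  obtains G where "finite G" "G \<subseteq> exponents n" "\<And>g i. g \<in> G \<Longrightarrow> Poly_Mapping.lookup g i \<le> 1"
    "I = monomial_ideal n G"
proof -
  obtain A where A: "A \<subseteq> squarefree_monomials n" and I: "I = Idl\<^bsub>polynomial_ring n\<^esub> A"
    using assms unfolding squarefree_monomial_ideal_def by blast
  define G where "G = {m \<in> exponents n. (\<forall>i. Poly_Mapping.lookup m i \<le> 1) \<and> (monomial m :: 'k polynomial) \<in> A}"
  have A_eq: "A = monomial ` G"
    using A unfolding G_def squarefree_monomials_def exponents_def by blast
  have "finite G"
    using finite_squarefree_exponents by (rule rev_finite_subset) (auto simp: G_def)
  moreover have G: "G \<subseteq> exponents n" by (auto simp: G_def)
  moreover have "I = monomial_ideal n G"
    unfolding I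
  proof (rule genideal_eq_monomial_ideal[OF G])
    show "A \<subseteq> monomial_ideal n G"
    proof
      fix p assume "p \<in> A"
      then obtain g where g: "p = monomial g" "g \<in> G" unfolding A_eq by blast
      then show "p \<in> monomial_ideal n G"
        using set_plus_intro[OF g(2) zero_in_exponents[of n]]
        by (simp add: monomial_ideal_def monomial_def)
    qed
  qed (simp add: A_eq)
  ultimately show ?thesis using that by (auto simp: G_def)
qed

theorem theorem2p7:
  fixes n :: nat
    and I :: "('k::field) polynomial set"
    and R S :: "'k polynomial ring"
    and L :: "'k polynomial set"
  assumes "n \<ge> 1"
    and "R = polynomial_ring n"
    and "S = polynomial_ring (n + 1)"
    and "squarefree_monomial_ideal n I"
    and "normal_ideal R I"
    and "L = Idl\<^bsub>S\<^esub> I \<inter> Idl\<^bsub>S\<^esub> {variable n, variable (n + 1)}"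
  shows "normal_ideal S L"
proof -
  obtain G where G: "finite G" "G \<subseteq> exponents n"
    and sqf: "\<And>g i. g \<in> G \<Longrightarrow> Poly_Mapping.lookup g i \<le> 1" and I: "I = monomial_ideal n G"
    using squarefree_monomial_idealE[OF assms(4)] by blast
  have sqf_n: "\<forall>g\<in>G. Poly_Mapping.lookup g n \<le> 1" using sqf by blast
  let ?E = "edge_exponents n G"
  note E = edge_exponents_subset[OF assms(1) G(2)]
  have L: "L = monomial_ideal (n + 1) ?E"
    unfolding assms(6) assms(3) I by (rule monomial_ideal_edge_exponents[OF assms(1) G(2) sqf_n])
  have "integrally_closed S (ideal_power S L t)" if t: "t \<ge> 1" for t
  proof -
    have X: "nfold_sumset ?E t \<subseteq> exponents (n + 1)"
      by (rule nfold_sumset_subset_exponents[OF E])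
    \<comment> \<open>Normality of \<open>I\<close> enters here, for the same \<open>t\<close> as in
      the power of \<open>L\<close>.\<close>
    have closed: "integrally_closed (polynomial_ring n) (monomial_ideal n (nfold_sumset G t) :: 'k polynomial set)"
      using assms(5) t unfolding normal_ideal_def assms(2) I ideal_power_monomial_ideal[OF G(2)] by blast
    show ?thesis
      unfolding L assms(3) ideal_power_monomial_ideal[OF E] integrally_closed_def integral_closure_def
      using integral_in_edge_power[OF assms(1) G sqf_n closed] integral_over_self[OF X]
        monomial_ideal_subset_carrier[OF X] by auto
  qed
  moreover have "ideal L S"
    unfolding L assms(3) by (rule monomial_ideal_is_ideal[OF E])
  ultimately show ?thesis unfolding normal_ideal_def by blast
qed

end
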